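(* Let $\tilde\beta\in(0,1)$. Consider the conditions (C2.1): there exist symmetric positive definite $Q^{(k)}\in\mathbb{R}^{\tilde n\times\tilde n}$, $k\in\{1,\dots,N\}$, $H\in\mathbb{R}^{n\times n}$ and $L\in\mathbb{R}^{m\times n}$ such that $S^{(k)}_{\rm qmi}(Q^{(k)},H,L,\tilde\beta)\succeq0$ for all $k$; (C2.2): there exist symmetric positive definite $Q^{(k)}$, $H$, $L$ such that $S^{(k)}_{\rm qmi}(Q^{(k)},H,L,1)\succ0$ for all $k$; and the conditions (C1.1): there exist symmetric positive definite $P^{(k)}\in\mathbb{R}^{\tilde n\times\tilde n}$, $G\in\mathbb{R}^{\tilde n\times\tilde n}$, $K\in\mathbb{R}^{m\times n}$ with $\begin{bmatrix}\tilde\beta^2P^{(k)} & \mathcal{C}(F^{(k)}(K))^\top G\\ G^\top\mathcal{C}(F^{(k)}(K)) & G^\top+G-P^{(k)}\end{bmatrix}\succeq0$ for all $k$; (C1.2): the same with $\tilde\beta$ replaced by $1$ and $\succeq$ replaced by $\succ$. Then (C2.1) implies (C1.1), and (C2.2) implies (C1.2), with the choices $$P^{(k)}=G^\top Q^{(k)}G,\qquad G=\mathcal{C}(H\otimes H)^{-1},\qquad K=LH^{-1}$$ (where these inverses exist). Furthermore, if the $Q^{(k)}$ are identical for all $k$, then the $P^{(k)}$ so defined are identical.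
   Context: Let $n,m,N$ be positive integers, $\tilde n=n(n+1)/2$. $\mathrm{vec}$ stacks columns; $\mathrm{vech}(X)$ stacks columnwise the entries on and below the diagonal. $E_e\in\mathbb{R}^{\tilde n\times n^2}$ satisfies $E_e\mathrm{vec}(X)=\mathrm{vech}(X)$ for all $X\in\mathbb{R}^{n\times n}$, $D\in\mathbb{R}^{n^2\times\tilde n}$ satisfies $D\mathrm{vech}(Y)=\mathrm{vec}(Y)$ for all symmetric $Y$, $\mathcal{C}(Y):=E_eYD$ for $Y\in\mathbb{R}^{n^2\times n^2}$. Let $M^{(1)},\dots,M^{(N)}\in\mathbb{R}^{n(n+m)\times n(n+m)}$ be symmetric (second-moment vertices of an SMP system), with blocks $M^{(k)}_{i,j}\in\mathbb{R}^{n\times n}$, $i,j\le n+m$. Column $n(j-1)+i$ of $F^{(k)}_{aa}\in\mathbb{R}^{n^2\times n^2}$ is $\mathrm{vec}(M^{(k)}_{i,j})$; column $m(j-1)+i'$ of $F^{(k)}_{ab}\in\mathbb{R}^{n^2\times nm}$ is $\mathrm{vec}(M^{(k)}_{n+i',j})$; column $n(j'-1)+i$ of $F^{(k)}_{ba}\in\mathbb{R}^{n^2\times nm}$ is $\mathrm{vec}(M^{(k)}_{i,n+j'})$; column $m(j'-1)+i'$ of $F^{(k)}_{bb}\in\mathbb{R}^{n^2\times m^2}$ is $\mathrm{vec}(M^{(k)}_{n+i',n+j'})$ ($i,j\le n$, $i',j'\le m$). $F^{(k)}(K):=F^{(k)}_{aa}-F^{(k)}_{ab}(I_n\otimes K)-F^{(k)}_{ba}(K\otimes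 I_n)+F^{(k)}_{bb}(K\otimes K)$. Define $F^{(k)}_{\rm qmi}(L,H):=\mathcal{C}\big(F^{(k)}_{aa}(H\otimes H)-F^{(k)}_{ab}(H\otimes L)-F^{(k)}_{ba}(L\otimes H)+F^{(k)}_{bb}(L\otimes L)\big)$ and $S^{(k)}_{\rm qmi}(Q,H,L,\tilde\beta):=\begin{bmatrix}\tilde\beta^2Q & F^{(k)}_{\rm qmi}(L,H)^\top\\ F^{(k)}_{\rm qmi}(L,H) & \mathcal{C}(H\otimes H)+\mathcal{C}(H\otimes H)^\top-Q\end{bmatrix}$ for symmetric $Q\in\mathbb{R}^{\tilde n\times\tilde n}$. *)

theory Defs
  imports "Jordan_Normal_Form.Matrix"
begin

definition psd_mat :: "real mat \<Rightarrow> bool" where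
  "psd_mat A \<longleftrightarrow> A \<in> carrier_mat (dim_row A) (dim_row A) \<and> transpose_mat A = A \<and>
     (\<forall>x \<in> carrier_vec (dim_row A). 0 \<le> x \<bullet> (A *\<^sub>v x))"

definition pd_mat :: "real mat \<Rightarrow> bool" where
  "pd_mat A \<longleftrightarrow> A \<in> carrier_mat (dim_row A) (dim_row A) \<and> transpose_mat A = A \<and>
     (\<forall>x \<in> carrier_vec (dim_row A). x \<noteq> 0\<^sub>v (dim_row A) \<longrightarrow> 0 < x \<bullet> (A *\<^sub>v x))"

definition kron :: "real mat \<Rightarrow> real mat \<Rightarrow> real mat" (infixl \<open>\<otimes>\<^sub>k\<close> 71) where
  "A \<otimes>\<^sub>k B = mat (dim_row A * dim_row B) (dim_col A * dim_col B)
     (\<lambda>(i,j). A $$ (i div dim_row B, j div dim_col B) * B $$ (i mod dim_row B, j mod dim_col B))"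

definition vecm :: "real mat \<Rightarrow> real vec" where
  "vecm X = vec_of_list (concat (map (\<lambda>j. map (\<lambda>i. X $$ (i,j)) [0..<dim_row X]) [0..<dim_col X]))"

definition vech :: "real mat \<Rightarrow> real vec" where
  "vech X = vec_of_list (concat (map (\<lambda>j. map (\<lambda>i. X $$ (i,j)) [j..<dim_row X]) [0..<dim_col X]))"

definition ntil :: "nat \<Rightarrow> nat" where
  "ntil n = n * (n + 1) div 2"

text \<open>Elimination matrix E_e and duplication matrix D, defined by their characterising
  properties (both are uniquely determined by them).\<close>
definition Ee :: "nat \<Rightarrow> real mat" where
  "Ee n = (THE E. E \<in> carrier_mat (ntil n) (n * n) \<and>
              (\<forall>X \<in> carrier_mat n n. E *\<^sub>v vecm X = vech X))"

definition Dup :: "nat \<Rightarrow> real mat" where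
  "Dup n = (THE D. D \<in> carrier_mat (n * n) (ntil n) \<and>
              (\<forall>Y \<in> carrier_mat n n. transpose_mat Y = Y \<longrightarrow> D *\<^sub>v vech Y = vecm Y))"

definition Cop :: "nat \<Rightarrow> real mat \<Rightarrow> real mat" where
  "Cop n Y = Ee n * Y * Dup n"

definition blk :: "nat \<Rightarrow> real mat \<Rightarrow> nat \<Rightarrow> nat \<Rightarrow> real mat" where
  "blk n M i j = mat n n (\<lambda>(a,b). M $$ (n * i + a, n * j + b))"

definition Faa :: "nat \<Rightarrow> nat \<Rightarrow> real mat \<Rightarrow> real mat" where
  "Faa n m M = mat (n*n) (n*n) (\<lambda>(r,c). vecm (blk n M (c mod n) (c div n)) $ r)"

definition Fab :: "nat \<Rightarrow> nat \<Rightarrow> real mat \<Rightarrow> real mat" where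
  "Fab n m M = mat (n*n) (n*m) (\<lambda>(r,c). vecm (blk n M (n + c mod m) (c div m)) $ r)"

definition Fba :: "nat \<Rightarrow> nat \<Rightarrow> real mat \<Rightarrow> real mat" where
  "Fba n m M = mat (n*n) (n*m) (\<lambda>(r,c). vecm (blk n M (c mod n) (n + c div n)) $ r)"

definition Fbb :: "nat \<Rightarrow> nat \<Rightarrow> real mat \<Rightarrow> real mat" where
  "Fbb n m M = mat (n*n) (m*m) (\<lambda>(r,c). vecm (blk n M (n + c mod m) (n + c div m)) $ r)"

definition FK :: "nat \<Rightarrow> nat \<Rightarrow> real mat \<Rightarrow> real mat \<Rightarrow> real mat" where
  "FK n m M K = Faa n m M - Fab n m M * (1\<^sub>m n \<otimes>\<^sub>k K) - Fba n m M * (K \<otimes>\<^sub>k 1\<^sub>m n)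
                + Fbb n m M * (K \<otimes>\<^sub>k K)"

definition Fqmi :: "nat \<Rightarrow> nat \<Rightarrow> real mat \<Rightarrow> real mat \<Rightarrow> real mat \<Rightarrow> real mat" where
  "Fqmi n m M L H = Cop n (Faa n m M * (H \<otimes>\<^sub>k H) - Fab n m M * (H \<otimes>\<^sub>k L)
                           - Fba n m M * (L \<otimes>\<^sub>k H) + Fbb n m M * (L \<otimes>\<^sub>k L))"

definition Sqmi :: "nat \<Rightarrow> nat \<Rightarrow> real mat \<Rightarrow> real mat \<Rightarrow> real mat \<Rightarrow> real mat \<Rightarrow> real \<Rightarrow> real mat" where
  "Sqmi n m M Q H L b = four_block_mat (b\<^sup>2 \<cdot>\<^sub>m Q) (transpose_mat (Fqmi n m M L H))
      (Fqmi n m M L H)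
      (Cop n (H \<otimes>\<^sub>k H) + transpose_mat (Cop n (H \<otimes>\<^sub>k H)) - Q)"

definition S1 :: "nat \<Rightarrow> nat \<Rightarrow> real mat \<Rightarrow> real mat \<Rightarrow> real mat \<Rightarrow> real mat \<Rightarrow> real \<Rightarrow> real mat" where
  "S1 n m M P G K b = four_block_mat (b\<^sup>2 \<cdot>\<^sub>m P)
      (transpose_mat (Cop n (FK n m M K)) * G)
      (transpose_mat G * Cop n (FK n m M K))
      (transpose_mat G + G - P)"

end

theory Submission
  imports Defs "Jordan_Normal_Form.Determinant"
begin

text \<open>Symmetric matrices are stable under \<open>X \<mapsto> H X H\<^sup>T\<close>, so \<open>Dup n * Ee n\<close> fixes the range of
  \<open>(H \<otimes> H) * Dup n\<close>, and the compression \<open>Cop n\<close> satisfies \<open>Cop n (Y (H \<otimes> H)) = Cop n Y * Cop n (H \<otimes> H)\<close>.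
  With \<open>K = L H\<^sup>-\<^sup>1\<close> the mixed product rule then gives
  \<open>Fqmi(L, H) = Cop n (F(K)) * Cop n (H \<otimes> H)\<close>, so that the congruence with
  \<open>diag(G, G)\<close>, \<open>G = Cop n (H \<otimes> H)\<^sup>-\<^sup>1\<close>, carries the block matrix of the second condition to that
  of the first. The inverses exist because the lower right block forces the symmetric part of
  \<open>Cop n (H \<otimes> H)\<close> to be positive definite.\<close>

section \<open>Definite matrices\<close>

lemma mult_mat_zero_vec [simp]: "A \<in> carrier_mat r c \<Longrightarrow> A *\<^sub>v 0\<^sub>v c = 0\<^sub>v r"
  by (intro eq_vecI) auto

text \<open>Moving the outer transpose across the scalar product turns the congruence into a
  substitution of \<open>T *\<^sub>v x\<close>; both definiteness transfers below rest on
  this.\<close>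

lemma quadratic_form_congruence:
  fixes S T :: "real mat"
  assumes S: "S \<in> carrier_mat p p" and T: "T \<in> carrier_mat p q" and x: "x \<in> carrier_vec q"
  shows "x \<bullet> ((transpose_mat T * S * T) *\<^sub>v x) = (T *\<^sub>v x) \<bullet> (S *\<^sub>v (T *\<^sub>v x))"
proof -
  have Tx: "T *\<^sub>v x \<in> carrier_vec p" using T x by simp
  have STx: "S *\<^sub>v (T *\<^sub>v x) \<in> carrier_vec p" using S Tx by simp
  have "(transpose_mat T * S * T) *\<^sub>v x = transpose_mat T *\<^sub>v (S *\<^sub>v (T *\<^sub>v x))"
    using S T x by (simp add: assoc_mult_mat_vec[of _ q p _ q] assoc_mult_mat_vec[of _ q p _ p])
  then have "x \<bullet> ((transpose_mat T * S * T) *\<^sub>v x)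
      = (transpose_mat T *\<^sub>v (S *\<^sub>v (T *\<^sub>v x))) \<bullet> x"
    using T STx x by (simp add: comm_scalar_prod[of x q])
  also have "\<dots> = (S *\<^sub>v (T *\<^sub>v x)) \<bullet> (T *\<^sub>v x)"
    by (rule transpose_vec_mult_scalar[OF T x STx])
  also have "\<dots> = (T *\<^sub>v x) \<bullet> (S *\<^sub>v (T *\<^sub>v x))"
    using STx Tx by (rule comm_scalar_prod)
  finally show ?thesis .
qed

lemma transpose_congruence:
  fixes S T :: "real mat"
  assumes S: "S \<in> carrier_mat p p" and T: "T \<in> carrier_mat p q" and sym: "transpose_mat S = S"
  shows "transpose_mat (transpose_mat T * S * T) = transpose_mat T * S * T"
proof -
  have "transpose_mat (transpose_mat T * S * T) = transpose_mat T * (transpose_mat S * T)"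
    using S T by (simp add: transpose_mult[of _ q p _ q] transpose_mult[of _ p p _ q])
  then show ?thesis
    using S T sym by (simp add: assoc_mult_mat[of _ q p _ p _ q])
qed

lemma psd_mat_congruence:
  assumes S: "S \<in> carrier_mat p p" and T: "T \<in> carrier_mat p q" and psd: "psd_mat S"
  shows "psd_mat (transpose_mat T * S * T)"
  using assms transpose_congruence[OF S T] quadratic_form_congruence[OF S T]
  unfolding psd_mat_def by auto

text \<open>The left inverse \<open>U\<close> makes \<open>T\<close> injective, so a nonzero
  \<open>x\<close> is sent to a nonzero vector and strictness survives the substitution.\<close>

lemma pd_mat_congruence:
  assumes S: "S \<in> carrier_mat p p" and T: "T \<in> carrier_mat p q" and pd: "pd_mat S"
    and U: "U \<in> carrier_mat q p" and UT: "U * T = 1\<^sub>m q"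
  shows "pd_mat (transpose_mat T * S * T)"
proof -
  have "T *\<^sub>v x \<noteq> 0\<^sub>v p" if x: "x \<in> carrier_vec q" "x \<noteq> 0\<^sub>v q" for x
  proof
    assume "T *\<^sub>v x = 0\<^sub>v p"
    then have "(U * T) *\<^sub>v x = 0\<^sub>v q"
      using U T x by (simp add: assoc_mult_mat_vec[of U q p])
    then show False using UT x by simp
  qed
  then show ?thesis
    using assms transpose_congruence[OF S T] quadratic_form_congruence[OF S T]
    unfolding pd_mat_def by auto
qed

lemma pd_mat_imp_psd_mat: "pd_mat A \<Longrightarrow> psd_mat A"
  unfolding pd_mat_def psd_mat_def
  by (metis less_eq_real_def mult_mat_vec_carrier scalar_prod_left_zero)

lemma psd_mat_lower_right_block:
  assumes A: "A \<in> carrier_mat p p" and B: "B \<in> carrier_mat p q"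
    and C: "C \<in> carrier_mat q p" and D: "D \<in> carrier_mat q q"
    and psd: "psd_mat (four_block_mat A B C D)" and x: "x \<in> carrier_vec q"
  shows "0 \<le> x \<bullet> (D *\<^sub>v x)"
proof -
  \<comment> \<open>Padding with zeros removes every contribution to the form except that of
    \<open>D\<close>.\<close>
  let ?z = "0\<^sub>v p @\<^sub>v x"
  have "0 \<le> ?z \<bullet> (four_block_mat A B C D *\<^sub>v ?z)"
    using psd x A D unfolding psd_mat_def by auto
  also have "four_block_mat A B C D *\<^sub>v ?z = (B *\<^sub>v x) @\<^sub>v (D *\<^sub>v x)"
    using A B C D x by (subst four_block_mat_mult_vec[OF A B C D]) auto
  also have "?z \<bullet> ((B *\<^sub>v x) @\<^sub>v (D *\<^sub>v x)) = x \<bullet> (D *\<^sub>v x)"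
    using B D x by (subst scalar_prod_append[of _ p _ q]) auto
  finally show ?thesis .
qed

section \<open>Invertibility criteria\<close>

lemma invertible_mat_if_trivial_kernel:
  fixes A :: "'a::field mat"
  assumes A: "A \<in> carrier_mat n n"
    and ker: "\<And>v. v \<in> carrier_vec n \<Longrightarrow> A *\<^sub>v v = 0\<^sub>v n \<Longrightarrow> v = 0\<^sub>v n"
  shows "invertible_mat A"
proof -
  \<comment> \<open>A singular matrix over a field would kill a nonzero vector; a nonzero
    determinant makes \<open>A\<close> a unit of the matrix ring, which supplies a two-sided
    inverse.\<close>
  have "det A \<noteq> 0" using det_0_iff_vec_prod_zero_field[OF A] ker by auto
  from det_non_zero_imp_unit[OF A this, of "()"]
  obtain B where "B \<in> carrier_mat n n" "A * B = 1\<^sub>m n" "B * A = 1\<^sub>m n"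
    unfolding Units_def ring_mat_def by auto
  then show ?thesis using A unfolding invertible_mat_def inverts_mat_def by auto
qed

text \<open>A definite \<open>Q\<close> below \<open>C + C\<^sup>T\<close> forces \<open>x\<^sup>T C x > 0\<close> for \<open>x \<noteq> 0\<close>.\<close>
lemma invertible_mat_if_symmetric_part_dominates:
  assumes C: "C \<in> carrier_mat p p" and Q: "Q \<in> carrier_mat p p" and pd: "pd_mat Q"
    and nonneg: "\<And>x. x \<in> carrier_vec p \<Longrightarrow> 0 \<le> x \<bullet> ((C + transpose_mat C - Q) *\<^sub>v x)"
  shows "invertible_mat C"
proof (rule invertible_mat_if_trivial_kernel[OF C])
  fix v assume v: "v \<in> carrier_vec p" and Cv: "C *\<^sub>v v = 0\<^sub>v p"
  \<comment> \<open>A matrix and its transpose have the same quadratic form, so the transposed term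
    also vanishes on the kernel of \<open>C\<close>.\<close>
  have Ctv: "v \<bullet> (transpose_mat C *\<^sub>v v) = 0"
  proof -
    have "v \<bullet> (transpose_mat C *\<^sub>v v) = (transpose_mat C *\<^sub>v v) \<bullet> v"
      using C v by (intro comm_scalar_prod[of _ p]) auto
    also have "\<dots> = v \<bullet> (C *\<^sub>v v)" by (rule transpose_vec_mult_scalar[OF C v v])
    finally show ?thesis using Cv v by simp
  qed
  have "(C + transpose_mat C - Q) *\<^sub>v v = C *\<^sub>v v + transpose_mat C *\<^sub>v v - Q *\<^sub>v v"
    using C Q v by (simp add: minus_mult_distrib_mat_vec[of _ p p] add_mult_distrib_mat_vec[of _ p p])
  \<comment> \<open>Only the contribution of \<open>Q\<close> is left, with a negative sign;
    nonnegativity then contradicts definiteness of \<open>Q\<close> unless \<open>v\<close> is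
    zero.\<close>
  then have "v \<bullet> ((C + transpose_mat C - Q) *\<^sub>v v) = - (v \<bullet> (Q *\<^sub>v v))"
    using C Q v Ctv Cv
    by (simp add: scalar_prod_minus_distrib[of _ p] scalar_prod_add_distrib[of _ p])
  with nonneg[OF v] have "\<not> 0 < v \<bullet> (Q *\<^sub>v v)" by simp
  then show "v = 0\<^sub>v p" using pd v Q unfolding pd_mat_def by auto
qed

section \<open>Kronecker products and vectorization\<close>

text \<open>Kronecker products and column stacking encode an index pair as \<open>a * q + b\<close>;
  this decodes a sum over the flat index into a double sum.\<close>

lemma sum_div_mod:
  fixes f :: "nat \<Rightarrow> nat \<Rightarrow> 'a::comm_monoid_add"
  shows "(\<Sum>k = 0..<p * q. f (k div q) (k mod q)) = (\<Sum>a = 0..<p. \<Sum>b = 0..<q. f a b)"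
proof -
  \<comment> \<open>On the block of length \<open>q\<close> starting at \<open>a * q\<close> the
    quotient is constantly \<open>a\<close> and the remainder runs through all residues.\<close>
  have "(\<Sum>k = a * q..<a * q + q. f (k div q) (k mod q)) = (\<Sum>b = 0..<q. f a b)" for a
    using sum.shift_bounds_nat_ivl[of "\<lambda>k. f (k div q) (k mod q)" 0 "a * q" q]
    by (simp add: add.commute)
  then show ?thesis
    using sum.nat_group[of "\<lambda>k. f (k div q) (k mod q)" q p]
    by (simp add: lessThan_atLeast0)
qed

lemma div_mod_less_mult:
  fixes k :: nat
  assumes "k < p * q"
  shows "k div q < p" and "k mod q < q"
  using assms by (auto simp: less_mult_imp_div_less intro!: mod_less_divisor gr0I)

lemma kron_carrier [simp]:
  "A \<in> carrier_mat a b \<Longrightarrow> B \<in> carrier_mat c d \<Longrightarrow> A \<otimes>\<^sub>k B \<in> carrier_mat (a * c) (b * d)"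
  unfolding kron_def by auto

text \<open>Mixed product rule: after splitting the summation index into quotient and remainder, the
  double sum factors into the two matrix product entries.\<close>

lemma kron_mult:
  assumes A: "A \<in> carrier_mat a b" and B: "B \<in> carrier_mat c d"
    and A': "A' \<in> carrier_mat b e" and B': "B' \<in> carrier_mat d f"
  shows "(A \<otimes>\<^sub>k B) * (A' \<otimes>\<^sub>k B') = (A * A') \<otimes>\<^sub>k (B * B')"
proof (rule eq_matI)
  fix i j
  assume "i < dim_row ((A * A') \<otimes>\<^sub>k (B * B'))" "j < dim_col ((A * A') \<otimes>\<^sub>k (B * B'))"
  then have ij: "i < a * c" "j < e * f" using A B A' B' by (auto simp: kron_def)
  note [simp] = div_mod_less_mult[OF ij(1)] div_mod_less_mult[OF ij(2)]
  have "((A \<otimes>\<^sub>k B) * (A' \<otimes>\<^sub>k B')) $$ (i,j)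
      = (\<Sum>k = 0..<b * d. (A $$ (i div c, k div d) * B $$ (i mod c, k mod d)) *
            (A' $$ (k div d, j div f) * B' $$ (k mod d, j mod f)))"
    using A B A' B' ij by (auto simp: kron_def scalar_prod_def intro!: sum.cong)
  also have "\<dots> = (\<Sum>x = 0..<b. \<Sum>y = 0..<d. (A $$ (i div c, x) * A' $$ (x, j div f)) *
            (B $$ (i mod c, y) * B' $$ (y, j mod f)))"
    by (subst sum_div_mod) (simp add: ac_simps)
  also have "\<dots> = ((A * A') \<otimes>\<^sub>k (B * B')) $$ (i,j)"
    using A B A' B' ij by (simp add: kron_def scalar_prod_def sum_product)
  finally show "((A \<otimes>\<^sub>k B) * (A' \<otimes>\<^sub>k B')) $$ (i,j) = ((A * A') \<otimes>\<^sub>k (B * B')) $$ (i,j)" .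
qed (use A B A' B' in \<open>auto simp: kron_def\<close>)

text \<open>All columns have length \<open>r\<close>, so position \<open>k\<close> lies in column
  \<open>k div r\<close> at row \<open>k mod r\<close>; this gives an entrywise formula for
  \<open>vecm\<close>.\<close>

lemma concat_map_upt_rectangle:
  "concat (map (\<lambda>j. map (\<lambda>i. f i j) [0..<r]) [0..<c]) = map (\<lambda>k. f (k mod r) (k div r)) [0..<c * r]"
proof (induction c)
  case (Suc c)
  have "map (\<lambda>k. f (k mod r) (k div r)) [c * r..<c * r + r] = map (\<lambda>i. f i c) [0..<r]"
    by (rule nth_equalityI) auto
  then show ?case
    using Suc upt_add_eq_append[of 0 "c * r" r] by (simp add: add.commute)
qed simp

lemma vecm_eq_vec:
  assumes "X \<in> carrier_mat r c"
  shows "vecm X = vec (c * r) (\<lambda>k. X $$ (k mod r, k div r))"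
  using assms
  by (intro eq_vecI)
    (auto simp: vecm_def concat_map_upt_rectangle[of "\<lambda>i j. X $$ (i,j)"] vec_of_list_index)

lemma vecm_carrier [simp]: "X \<in> carrier_mat r c \<Longrightarrow> vecm X \<in> carrier_vec (c * r)"
  by (simp add: vecm_eq_vec)

text \<open>Lets a matrix be determined by its action on stacked matrices, as needed for uniqueness
  of \<open>Ee\<close>.\<close>

lemma vecm_surj:
  assumes "v \<in> carrier_vec (c * r)"
  obtains X where "X \<in> carrier_mat r c" "vecm X = v"
proof
  let ?X = "mat r c (\<lambda>(i,j). v $ (j * r + i))"
  show X: "?X \<in> carrier_mat r c" by simp
  show "vecm ?X = v"
    using assms by (auto simp: vecm_eq_vec[OF X] div_mod_less_mult intro!: eq_vecI)
qed

lemma vecm_inj: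
  assumes X: "X \<in> carrier_mat r c" and Y: "Y \<in> carrier_mat r c" and eq: "vecm X = vecm Y"
  shows "X = Y"
proof (rule eq_matI)
  fix i j assume "i < dim_row Y" "j < dim_col Y"
  then have ij: "i < r" "j < c" using Y by auto
  \<comment> \<open>The flat index of the entry must stay within the stacked vector, whose length is
    \<open>c * r\<close>.\<close>
  have "j * r + i < j * r + r" using ij by simp
  also have "\<dots> \<le> c * r" using ij mult_le_mono1[of "Suc j" c r] by simp
  finally have "j * r + i < c * r" .
  then show "X $$ (i,j) = Y $$ (i,j)"
    using ij arg_cong[OF eq, of "\<lambda>v. v $ (j * r + i)"]
    by (simp add: vecm_eq_vec[OF X] vecm_eq_vec[OF Y])
qed (use X Y in auto)

text \<open>The first factor acts on the column index of \<open>X\<close> and the second on its row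
  index, because stacking is by columns; hence \<open>A\<close> appears transposed on the
  right.\<close>

lemma kron_mult_vecm:
  assumes A: "A \<in> carrier_mat p q" and B: "B \<in> carrier_mat r s" and X: "X \<in> carrier_mat s q"
  shows "(A \<otimes>\<^sub>k B) *\<^sub>v vecm X = vecm (B * X * transpose_mat A)"
proof (rule eq_vecI)
  have Z: "B * X * transpose_mat A \<in> carrier_mat r p" using A B X by auto
  fix i assume "i < dim_vec (vecm (B * X * transpose_mat A))"
  then have i: "i < p * r" by (simp add: vecm_eq_vec[OF Z])
  note [simp] = div_mod_less_mult[OF i]
  have "((A \<otimes>\<^sub>k B) *\<^sub>v vecm X) $ i
      = (\<Sum>k = 0..<q * s. A $$ (i div r, k div s) * B $$ (i mod r, k mod s) * X $$ (k mod s, k div s))"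
    using A B X i by (auto simp: kron_def scalar_prod_def vecm_eq_vec[OF X] intro!: sum.cong)
  also have "\<dots> = (\<Sum>x = 0..<q. \<Sum>y = 0..<s. A $$ (i div r, x) * B $$ (i mod r, y) * X $$ (y, x))"
    by (rule sum_div_mod)
  also have "\<dots> = vecm (B * X * transpose_mat A) $ i"
    using A B X i by (auto simp: vecm_eq_vec[OF Z] scalar_prod_def sum_distrib_right sum_distrib_left
        ac_simps simp del: assoc_mult_mat intro!: sum.cong)
  finally show "((A \<otimes>\<^sub>k B) *\<^sub>v vecm X) $ i = vecm (B * X * transpose_mat A) $ i" .
qed (use A B X in \<open>auto simp: kron_def vecm_eq_vec[of _ r p]\<close>)

section \<open>Half-vectorization, elimination and duplication\<close>

text \<open>The reading order of \<open>vech\<close>, kept as a list of positions so that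
  coordinates can be handled by list indexing.\<close>

definition lower_positions :: "nat \<Rightarrow> (nat \<times> nat) list" where
  "lower_positions n = concat (map (\<lambda>j. map (\<lambda>i. (i,j)) [j..<n]) [0..<n])"

lemma set_lower_positions: "set (lower_positions n) = {(i,j). j \<le> i \<and> i < n}"
  by (fastforce simp: lower_positions_def)

lemma length_lower_positions: "length (lower_positions n) = ntil n"
proof -
  have "length (lower_positions n) = (\<Sum>j = 0..<n. n - j)"
    by (simp add: lower_positions_def length_concat o_def sum_list_distinct_conv_sum_set)
  \<comment> \<open>Reversing the order of summation turns the column lengths into the numbers from
    1 to \<open>n\<close>.\<close>
  also have "\<dots> = (\<Sum>j = 0..<n. Suc j)"
    using sum.nat_diff_reindex[of Suc n]
    by (simp add: lessThan_atLeast0) (metis (mono_tags, lifting) Suc_diff_Suc atLeastLessThan_iff sum.cong)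
  also have "\<dots> = ntil n"
    by (induction n) (auto simp: ntil_def)
  finally show ?thesis .
qed

lemma distinct_lower_positions: "distinct (lower_positions n)"
  unfolding lower_positions_def
proof (rule distinct_concat)
  \<comment> \<open>For \<open>j < n\<close> the list of column \<open>j\<close> starts with the
    diagonal position \<open>(j,j)\<close>, so its head identifies the column.\<close>
  show "distinct (map (\<lambda>j. map (\<lambda>i. (i,j)) [j..<n]) [0..<n])"
    by (auto simp: distinct_map inj_on_def upt_eq_Cons_conv dest!: arg_cong[of _ _ hd] simp: hd_map)
qed (auto simp: distinct_map inj_on_def)

lemma bij_betw_lower_positions:
  "bij_betw ((!) (lower_positions n)) {..<ntil n} {(i,j). j \<le> i \<and> i < n}"
  by (rule bij_betw_nth[OF distinct_lower_positions])
    (simp_all add: length_lower_positions set_lower_positions)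

text \<open>Inverse of the enumeration, taken abstractly to avoid a closed formula for the rank of a
  position; it is meaningful only on or below the diagonal.\<close>

definition lower_index :: "nat \<Rightarrow> nat \<times> nat \<Rightarrow> nat" where
  "lower_index n = inv_into {..<ntil n} ((!) (lower_positions n))"

lemma lower_index:
  assumes "j \<le> i" "i < n"
  shows "lower_index n (i,j) < ntil n" and "lower_positions n ! lower_index n (i,j) = (i,j)"
  using bij_betw_inv_into_right[OF bij_betw_lower_positions, of "(i,j)" n]
    bij_betw_apply[OF bij_betw_inv_into[OF bij_betw_lower_positions], of "(i,j)" n] assms
  by (auto simp: lower_index_def)

lemma lower_index_lower_positions:
  "k < ntil n \<Longrightarrow> lower_index n (lower_positions n ! k) = k"
  unfolding lower_index_def by (rule bij_betw_inv_into_left[OF bij_betw_lower_positions]) simp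

lemma lower_positionsE:
  assumes "k < ntil n"
  obtains i j where "lower_positions n ! k = (i,j)" "j \<le> i" "i < n"
  using bij_betw_apply[OF bij_betw_lower_positions, of k n] assms by auto

lemma vech_eq_vec:
  assumes "X \<in> carrier_mat n n"
  shows "vech X = vec (ntil n) (\<lambda>k. X $$ (lower_positions n ! k))"
proof -
  have "vech X = vec_of_list (map (\<lambda>p. X $$ p) (lower_positions n))"
    using assms by (simp add: vech_def lower_positions_def map_concat o_def)
  then show ?thesis
    by (auto intro!: eq_vecI simp: length_lower_positions vec_of_list_index)
qed

lemma vech_carrier [simp]: "X \<in> carrier_mat n n \<Longrightarrow> vech X \<in> carrier_vec (ntil n)"
  by (simp add: vech_eq_vec)

lemma vech_zero: "vech (0\<^sub>m n n) = 0\<^sub>v (ntil n)"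
  by (rule eq_vecI) (auto simp: vech_eq_vec[of _ n] elim!: lower_positionsE)

text \<open>Equalities of matrices acting on half-vectors can thus be tested on symmetric matrices
  alone, which is where \<open>Dup\<close> is specified.\<close>

lemma vech_surj_symmetric:
  assumes v: "v \<in> carrier_vec (ntil n)"
  obtains X where "X \<in> carrier_mat n n" "transpose_mat X = X" "vech X = v"
proof
  \<comment> \<open>The maximum and minimum reflect a position above the diagonal to its mirror
    image below it.\<close>
  let ?X = "mat n n (\<lambda>(i,j). v $ lower_index n (max i j, min i j))"
  show X: "?X \<in> carrier_mat n n" by simp
  show "transpose_mat ?X = ?X" by (rule eq_matI) (auto simp: max.commute min.commute)
  show "vech ?X = v"
  proof (rule eq_vecI)
    fix k assume "k < dim_vec v"
    then have k: "k < ntil n" using v by simp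
    obtain i j where ij: "lower_positions n ! k = (i,j)" "j \<le> i" "i < n"
      using lower_positionsE[OF k] .
    moreover from this have "vech ?X $ k = ?X $$ (i,j)" using k by (simp add: vech_eq_vec[OF X])
    ultimately show "vech ?X $ k = v $ k"
      using lower_index_lower_positions[OF k] by (simp add: max_absorb1 min_absorb2)
  qed (use v in \<open>simp add: vech_eq_vec[OF X]\<close>)
qed

section \<open>Existence and uniqueness of the elimination and duplication matrices\<close>

lemma eq_mat_if_mult_vec_eq:
  fixes A B :: "'a::semiring_1 mat"
  assumes A: "A \<in> carrier_mat r c" and B: "B \<in> carrier_mat r c"
    and eq: "\<And>v. v \<in> carrier_vec c \<Longrightarrow> A *\<^sub>v v = B *\<^sub>v v"
  shows "A = B"
proof (rule eq_matI)
  fix i j assume ij: "i < dim_row B" "j < dim_col B"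
  then have "(A *\<^sub>v unit_vec c j) $ i = (B *\<^sub>v unit_vec c j) $ i" using eq by simp
  then show "A $$ (i,j) = B $$ (i,j)" using ij A B by auto
qed (use A B in auto)

text \<open>Elimination and duplication only copy coordinates, so both are realised as 0/1 matrices
  of this shape.\<close>

definition selection_mat :: "nat \<Rightarrow> nat \<Rightarrow> (nat \<Rightarrow> nat) \<Rightarrow> real mat" where
  "selection_mat r c f = mat r c (\<lambda>(i,j). if j = f i then 1 else 0)"

lemma selection_mat_mult_vec:
  assumes "v \<in> carrier_vec c" and "\<And>i. i < r \<Longrightarrow> f i < c"
  shows "selection_mat r c f *\<^sub>v v = vec r (\<lambda>i. v $ f i)"
  using assms by (auto intro!: eq_vecI simp: selection_mat_def scalar_prod_def if_distrib if_distribR cong: if_cong)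

lemma elimination_mat_exists:
  "\<exists>E \<in> carrier_mat (ntil n) (n * n). \<forall>X \<in> carrier_mat n n. E *\<^sub>v vecm X = vech X"
proof (intro bexI ballI)
  \<comment> \<open>Column stacking puts the entry at row \<open>i\<close> and column
    \<open>j\<close> at index \<open>j * n + i\<close>.\<close>
  let ?f = "\<lambda>k. snd (lower_positions n ! k) * n + fst (lower_positions n ! k)"
  have f: "?f k < n * n" if k: "k < ntil n" for k
  proof -
    obtain i j where ij: "lower_positions n ! k = (i,j)" "j \<le> i" "i < n"
      using lower_positionsE[OF k] .
    then have "j * n + i < Suc j * n" by simp
    also have "\<dots> \<le> n * n" using ij by (intro mult_le_mono1) simp
    finally show ?thesis using ij by simp
  qed
  show "selection_mat (ntil n) (n * n) ?f \<in> carrier_mat (ntil n) (n * n)"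
    by (simp add: selection_mat_def)
  fix X :: "real mat" assume X: "X \<in> carrier_mat n n"
  show "selection_mat (ntil n) (n * n) ?f *\<^sub>v vecm X = vech X"
    using X f
    by (subst selection_mat_mult_vec)
      (auto simp: vech_eq_vec[OF X] vecm_eq_vec[OF X] intro!: eq_vecI elim!: lower_positionsE)
qed

text \<open>Two candidates agree on every stacked matrix, hence on every vector since stacking is
  onto; the definite description is therefore well defined.\<close>

lemma Ee_props:
  shows Ee_carrier [simp]: "Ee n \<in> carrier_mat (ntil n) (n * n)"
    and Ee_mult_vecm: "X \<in> carrier_mat n n \<Longrightarrow> Ee n *\<^sub>v vecm X = vech X"
proof -
  let ?P = "\<lambda>E. E \<in> carrier_mat (ntil n) (n * n) \<and> (\<forall>X \<in> carrier_mat n n. E *\<^sub>v vecm X = vech X)"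
  have "\<exists>!E. ?P E"
  proof (rule ex_ex1I)
    show "\<exists>E. ?P E" using elimination_mat_exists by blast
    fix E E' assume "?P E" "?P E'"
    then show "E = E'"
      by (intro eq_mat_if_mult_vec_eq[of _ "ntil n" "n * n"]) (auto elim: vecm_surj)
  qed
  from theI'[OF this] have "?P (Ee n)" unfolding Ee_def .
  then show "Ee n \<in> carrier_mat (ntil n) (n * n)"
    "X \<in> carrier_mat n n \<Longrightarrow> Ee n *\<^sub>v vecm X = vech X" by auto
qed

lemma duplication_mat_exists:
  "\<exists>D \<in> carrier_mat (n * n) (ntil n).
     \<forall>Y \<in> carrier_mat n n. transpose_mat Y = Y \<longrightarrow> D *\<^sub>v vech Y = vecm Y"
proof (intro bexI ballI impI)
  \<comment> \<open>Coordinate \<open>r\<close> of the stacked matrix belongs to row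
    \<open>r mod n\<close> and column \<open>r div n\<close>; its mirror image on or below the
    diagonal is the entry that \<open>vech\<close> stores.\<close>
  let ?p = "\<lambda>r. (max (r mod n) (r div n), min (r mod n) (r div n))"
  let ?f = "\<lambda>r. lower_index n (?p r)"
  have p: "snd (?p r) \<le> fst (?p r)" "fst (?p r) < n" if "r < n * n" for r
    using div_mod_less_mult[OF that] by auto
  have f: "?f r < ntil n" "lower_positions n ! ?f r = ?p r" if "r < n * n" for r
    using lower_index p[OF that] by auto
  show "selection_mat (n * n) (ntil n) ?f \<in> carrier_mat (n * n) (ntil n)"
    by (simp add: selection_mat_def)
  fix Y :: "real mat" assume Y: "Y \<in> carrier_mat n n" and sym: "transpose_mat Y = Y"
  have swap: "Y $$ (i,j) = Y $$ (j,i)" if "i < n" "j < n" for i j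
    using that Y arg_cong[OF sym, of "\<lambda>A. A $$ (i,j)"] by simp
  have "Y $$ ?p r = Y $$ (r mod n, r div n)" if "r < n * n" for r
    using div_mod_less_mult[OF that] swap by (auto simp: max_def min_def)
  then show "selection_mat (n * n) (ntil n) ?f *\<^sub>v vech Y = vecm Y"
    using Y f
    by (subst selection_mat_mult_vec)
      (auto simp: vech_eq_vec[OF Y] vecm_eq_vec[OF Y] intro!: eq_vecI)
qed

text \<open>The specification speaks only of symmetric matrices, but their half-vectors already
  exhaust the space, so it fixes \<open>Dup n\<close>.\<close>

lemma Dup_props:
  shows Dup_carrier [simp]: "Dup n \<in> carrier_mat (n * n) (ntil n)"
    and Dup_mult_vech: "Y \<in> carrier_mat n n \<Longrightarrow> transpose_mat Y = Y \<Longrightarrow> Dup n *\<^sub>v vech Y = vecm Y"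
proof -
  let ?P = "\<lambda>D. D \<in> carrier_mat (n * n) (ntil n) \<and>
    (\<forall>Y \<in> carrier_mat n n. transpose_mat Y = Y \<longrightarrow> D *\<^sub>v vech Y = vecm Y)"
  have "\<exists>!D. ?P D"
  proof (rule ex_ex1I)
    show "\<exists>D. ?P D" using duplication_mat_exists by blast
    fix D D' assume P: "?P D" "?P D'"
    show "D = D'"
    proof (rule eq_mat_if_mult_vec_eq[of _ "n * n" "ntil n"])
      fix v :: "real vec" assume "v \<in> carrier_vec (ntil n)"
      then obtain Y where "Y \<in> carrier_mat n n" "transpose_mat Y = Y" "vech Y = v"
        by (rule vech_surj_symmetric)
      then show "D *\<^sub>v v = D' *\<^sub>v v" using P by auto
    qed (use P in auto)
  qed
  from theI'[OF this] have "?P (Dup n)" unfolding Dup_def .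
  then show "Dup n \<in> carrier_mat (n * n) (ntil n)"
    "Y \<in> carrier_mat n n \<Longrightarrow> transpose_mat Y = Y \<Longrightarrow> Dup n *\<^sub>v vech Y = vecm Y" by auto
qed

section \<open>The compression \<open>Cop\<close> and Kronecker squares\<close>

lemma Cop_carrier [simp]: "Y \<in> carrier_mat (n * n) (n * n) \<Longrightarrow> Cop n Y \<in> carrier_mat (ntil n) (ntil n)"
  unfolding Cop_def by (meson Dup_carrier Ee_carrier mult_carrier_mat)

lemma Cop_mult_vec:
  assumes "Y \<in> carrier_mat (n * n) (n * n)" "v \<in> carrier_vec (ntil n)"
  shows "Cop n Y *\<^sub>v v = Ee n *\<^sub>v (Y *\<^sub>v (Dup n *\<^sub>v v))"
  using assms mult_carrier_mat[OF Ee_carrier assms(1)] mult_mat_vec_carrier[OF Dup_carrier assms(2)]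
  by (simp add: Cop_def assoc_mult_mat_vec[OF _ Dup_carrier] assoc_mult_mat_vec[OF Ee_carrier])

lemma transpose_congruence_symmetric:
  fixes H X :: "real mat"
  assumes "H \<in> carrier_mat n n" "X \<in> carrier_mat n n" "transpose_mat X = X"
  shows "transpose_mat (H * X * transpose_mat H) = H * X * transpose_mat H"
  using transpose_congruence[of X n "transpose_mat H" n] assms by simp

text \<open>\<open>Dup n\<close> restores the full stacking of the symmetric \<open>X\<close>, the
  Kronecker square applies the congruence by \<open>H\<close>, and \<open>Ee n\<close> compresses
  again.\<close>

lemma Cop_kron_mult_vech:
  assumes H: "H \<in> carrier_mat n n" and X: "X \<in> carrier_mat n n" "transpose_mat X = X"
  shows "Cop n (H \<otimes>\<^sub>k H) *\<^sub>v vech X = vech (H * X * transpose_mat H)"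
proof -
  have "H * X * transpose_mat H \<in> carrier_mat n n" using H X by auto
  then show ?thesis
    using kron_carrier[OF H H] H X
    by (simp add: Cop_mult_vec Dup_mult_vech kron_mult_vecm[OF H H] Ee_mult_vecm)
qed

text \<open>Multiplicativity holds because the right factor maps stacked symmetric matrices to
  stacked symmetric matrices, so compressing and duplicating in between loses nothing.\<close>

lemma Cop_mult_kron:
  assumes Y: "Y \<in> carrier_mat (n * n) (n * n)" and H: "H \<in> carrier_mat n n"
  shows "Cop n (Y * (H \<otimes>\<^sub>k H)) = Cop n Y * Cop n (H \<otimes>\<^sub>k H)"
proof (rule eq_mat_if_mult_vec_eq[of _ "ntil n" "ntil n"])
  note HH = kron_carrier[OF H H]
  show "Cop n (Y * (H \<otimes>\<^sub>k H)) \<in> carrier_mat (ntil n) (ntil n)"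
    using Y HH by (meson Cop_carrier mult_carrier_mat)
  show "Cop n Y * Cop n (H \<otimes>\<^sub>k H) \<in> carrier_mat (ntil n) (ntil n)"
    using Y HH by (meson Cop_carrier mult_carrier_mat)
  fix v :: "real vec" assume v: "v \<in> carrier_vec (ntil n)"
  then obtain X where X: "X \<in> carrier_mat n n" "transpose_mat X = X" and vX: "vech X = v"
    by (rule vech_surj_symmetric)
  let ?Z = "H * X * transpose_mat H"
  have Z: "?Z \<in> carrier_mat n n" using H X by auto
  have "Cop n (Y * (H \<otimes>\<^sub>k H)) *\<^sub>v v = Ee n *\<^sub>v (Y *\<^sub>v ((H \<otimes>\<^sub>k H) *\<^sub>v vecm X))"
    using Y HH v X vecm_carrier[OF X(1)] mult_carrier_mat[OF Y HH]
    by (simp add: Cop_mult_vec Dup_mult_vech flip: vX)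
  also have "\<dots> = Ee n *\<^sub>v (Y *\<^sub>v vecm ?Z)"
    by (simp add: kron_mult_vecm[OF H H X(1)])
  \<comment> \<open>Symmetry of \<open>?Z\<close> is what allows \<open>vecm ?Z\<close> to be
    rewritten as \<open>Dup n *\<^sub>v vech ?Z\<close>.\<close>
  also have "\<dots> = Cop n Y *\<^sub>v vech ?Z"
    using Y Z transpose_congruence_symmetric[OF H X] by (simp add: Cop_mult_vec Dup_mult_vech)
  also have "\<dots> = (Cop n Y * Cop n (H \<otimes>\<^sub>k H)) *\<^sub>v v"
    using Cop_carrier[OF Y] Cop_carrier[OF HH] v
    by (simp add: Cop_kron_mult_vech[OF H X] flip: vX)
  finally show "Cop n (Y * (H \<otimes>\<^sub>k H)) *\<^sub>v v = (Cop n Y * Cop n (H \<otimes>\<^sub>k H)) *\<^sub>v v" .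
qed

text \<open>If \<open>H v = 0\<close> with \<open>v \<noteq> 0\<close>, then \<open>vech (v v\<^sup>T)\<close> lies in the kernel of \<open>Cop n (H \<otimes> H)\<close>.\<close>
lemma invertible_mat_if_Cop_kron_invertible:
  assumes H: "H \<in> carrier_mat n n" and inv: "invertible_mat (Cop n (H \<otimes>\<^sub>k H))"
  shows "invertible_mat H"
proof (rule invertible_mat_if_trivial_kernel[OF H])
  fix v assume v: "v \<in> carrier_vec n" and Hv: "H *\<^sub>v v = 0\<^sub>v n"
  let ?C = "Cop n (H \<otimes>\<^sub>k H)"
  let ?X = "mat n n (\<lambda>(i,j). v $ i * v $ j)"
  have X: "?X \<in> carrier_mat n n" by simp
  have symX: "transpose_mat ?X = ?X" by (rule eq_matI) auto
  have C: "?C \<in> carrier_mat (ntil n) (ntil n)" using kron_carrier[OF H H] by simp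
  from inv obtain B where B: "?C * B = 1\<^sub>m (ntil n)" "B * ?C = 1\<^sub>m (dim_row B)"
    using C unfolding invertible_mat_def inverts_mat_def by auto
  \<comment> \<open>The dimensions of \<open>B\<close> follow from comparing column counts in the
    two inverse identities.\<close>
  have Bc: "B \<in> carrier_mat (ntil n) (ntil n)"
    using arg_cong[OF B(1), of dim_col] arg_cong[OF B(2), of dim_col] C by auto
  have "H * ?X = 0\<^sub>m n n"
  proof (rule eq_matI)
    fix i j assume ij: "i < dim_row (0\<^sub>m n n)" "j < dim_col (0\<^sub>m n n)"
    then have "(\<Sum>k = 0..<n. H $$ (i,k) * v $ k) = 0"
      using arg_cong[OF Hv, of "\<lambda>w. w $ i"] H v by (simp add: scalar_prod_def)
    then have "(\<Sum>k = 0..<n. H $$ (i,k) * v $ k) * v $ j = 0" by simp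
    then show "(H * ?X) $$ (i,j) = 0\<^sub>m n n $$ (i,j)"
      using ij H v by (simp add: scalar_prod_def sum_distrib_right mult.assoc)
  qed (use H in auto)
  then have "?C *\<^sub>v vech ?X = 0\<^sub>v (ntil n)"
    using H by (simp add: Cop_kron_mult_vech[OF H X symX] vech_zero)
  then have "(B * ?C) *\<^sub>v vech ?X = 0\<^sub>v (ntil n)"
    using Bc C vech_carrier[OF X] by (simp add: assoc_mult_mat_vec[OF Bc C])
  then have "vech ?X = vech (0\<^sub>m n n)"
    using B(2) Bc vech_carrier[OF X] by (simp add: vech_zero)
  \<comment> \<open>Both matrices are symmetric, so duplication recovers the full stacking from the
    half-vector.\<close>
  then have "vecm ?X = vecm (0\<^sub>m n n)"
    using Dup_mult_vech[OF X symX] Dup_mult_vech[of "0\<^sub>m n n" n] by simp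
  then have X0: "?X = 0\<^sub>m n n" by (intro vecm_inj[OF X]) auto
  \<comment> \<open>The diagonal entries of \<open>?X\<close> are the squares of the entries of
    \<open>v\<close>.\<close>
  have "v $ i = 0" if "i < n" for i
    using arg_cong[OF X0, of "\<lambda>A. A $$ (i,i)"] that by simp
  then show "v = 0\<^sub>v n" using v by (intro eq_vecI) auto
qed

section \<open>The congruence between the two conditions\<close>

lemma FK_carrier [simp]:
  "K \<in> carrier_mat m n \<Longrightarrow> FK n m M K \<in> carrier_mat (n * n) (n * n)"
  unfolding FK_def Faa_def Fab_def Fba_def Fbb_def kron_def by (auto simp: mult.commute)

lemma combination_mult_distrib_mat:
  fixes A :: "real mat"
  assumes "A \<in> carrier_mat p q" "B \<in> carrier_mat p q" "C \<in> carrier_mat p q"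
    "D \<in> carrier_mat p q" "X \<in> carrier_mat q r"
  shows "(A - B - C + D) * X = A * X - B * X - C * X + D * X"
proof -
  have AB: "A - B \<in> carrier_mat p q" and ABC: "A - B - C \<in> carrier_mat p q"
    using assms by auto
  show ?thesis
    unfolding add_mult_distrib_mat[OF ABC assms(4,5)] minus_mult_distrib_mat[OF AB assms(3,5)]
      minus_mult_distrib_mat[OF assms(1,2,5)] ..
qed

text \<open>Since \<open>K * H = L\<close> for \<open>K = L * Hi\<close>, multiplying the terms of
  \<open>FK\<close> by the Kronecker square of \<open>H\<close> produces the bilinear expressions of
  \<open>Fqmi\<close>; the common factor then comes out of \<open>Cop\<close>.\<close>

lemma Fqmi_eq_Cop_FK_mult:
  assumes H: "H \<in> carrier_mat n n" and L: "L \<in> carrier_mat m n"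
    and Hi: "Hi \<in> carrier_mat n n" "Hi * H = 1\<^sub>m n"
  shows "Fqmi n m M L H = Cop n (FK n m M (L * Hi)) * Cop n (H \<otimes>\<^sub>k H)"
proof -
  let ?K = "L * Hi"
  have K: "?K \<in> carrier_mat m n" using L Hi by auto
  have KH: "?K * H = L" using L Hi H by (simp add: assoc_mult_mat[OF L Hi(1) H])
  note HH = kron_carrier[OF H H]
  have aa: "Faa n m M \<in> carrier_mat (n * n) (n * n)" by (simp add: Faa_def)
  have ab: "Fab n m M \<in> carrier_mat (n * n) (n * m)" by (simp add: Fab_def)
  \<comment> \<open>The width is written as \<open>m * n\<close> to match the row count of
    \<open>KI\<close> below.\<close>
  have ba: "Fba n m M \<in> carrier_mat (n * n) (m * n)" by (simp add: Fba_def mult.commute)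
  have bb: "Fbb n m M \<in> carrier_mat (n * n) (m * m)" by (simp add: Fbb_def)
  have IK: "1\<^sub>m n \<otimes>\<^sub>k ?K \<in> carrier_mat (n * m) (n * n)"
    and KI: "?K \<otimes>\<^sub>k 1\<^sub>m n \<in> carrier_mat (m * n) (n * n)"
    and KK: "?K \<otimes>\<^sub>k ?K \<in> carrier_mat (m * m) (n * n)" using K by auto
  have "FK n m M ?K * (H \<otimes>\<^sub>k H) =
      Faa n m M * (H \<otimes>\<^sub>k H) - Fab n m M * (1\<^sub>m n \<otimes>\<^sub>k ?K) * (H \<otimes>\<^sub>k H)
      - Fba n m M * (?K \<otimes>\<^sub>k 1\<^sub>m n) * (H \<otimes>\<^sub>k H) + Fbb n m M * (?K \<otimes>\<^sub>k ?K) * (H \<otimes>\<^sub>k H)"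
    unfolding FK_def
    by (rule combination_mult_distrib_mat[OF aa mult_carrier_mat[OF ab IK] mult_carrier_mat[OF ba KI]
          mult_carrier_mat[OF bb KK] HH])
  also have "\<dots> = Faa n m M * (H \<otimes>\<^sub>k H) - Fab n m M * (H \<otimes>\<^sub>k L)
      - Fba n m M * (L \<otimes>\<^sub>k H) + Fbb n m M * (L \<otimes>\<^sub>k L)"
    using H
    by (simp add: assoc_mult_mat[OF ab IK HH] assoc_mult_mat[OF ba KI HH] assoc_mult_mat[OF bb KK HH]
        kron_mult[OF one_carrier_mat K H H] kron_mult[OF K one_carrier_mat H H]
        kron_mult[OF K K H H] KH)
  finally show ?thesis
    using Cop_mult_kron[OF FK_carrier[OF K] H, of M] by (simp add: Fqmi_def)
qed

text \<open>Conjugation by the block diagonal \<open>T\<close> acts separately on each block;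
  \<open>C * G = 1\<^sub>m p\<close> and its transpose cancel every \<open>C\<close> introduced
  through \<open>F * C\<close> and the symmetric part.\<close>

lemma block_congruence:
  fixes Q F C G :: "real mat"
  assumes Q: "Q \<in> carrier_mat p p" and F: "F \<in> carrier_mat p p"
    and C: "C \<in> carrier_mat p p" and G: "G \<in> carrier_mat p p" and CG: "C * G = 1\<^sub>m p"
  defines "T \<equiv> four_block_mat G (0\<^sub>m p p) (0\<^sub>m p p) G"
  shows "four_block_mat (b \<cdot>\<^sub>m (transpose_mat G * Q * G)) (transpose_mat F * G)
      (transpose_mat G * F) (transpose_mat G + G - transpose_mat G * Q * G)
    = transpose_mat T * four_block_mat (b \<cdot>\<^sub>m Q) (transpose_mat (F * C)) (F * C)
        (C + transpose_mat C - Q) * T"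
proof -
  let ?G = "transpose_mat G"
  have Gt: "?G \<in> carrier_mat p p" using G by simp
  have Ct: "transpose_mat C \<in> carrier_mat p p" using C by simp
  have Ft: "transpose_mat F \<in> carrier_mat p p" using F by simp
  have GC: "?G * transpose_mat C = 1\<^sub>m p"
    using transpose_mult[OF C G] CG by simp
  have FC: "F * C \<in> carrier_mat p p" "transpose_mat (F * C) \<in> carrier_mat p p" using F C by auto
  have D: "C + transpose_mat C - Q \<in> carrier_mat p p" using C Q by auto
  have Tt: "transpose_mat T = four_block_mat ?G (0\<^sub>m p p) (0\<^sub>m p p) ?G"
    unfolding T_def using G by (subst transpose_four_block_mat[of _ p p _ p _ p]) auto
  have Z: "0\<^sub>m p p \<in> carrier_mat p p" and Qb: "b \<cdot>\<^sub>m Q \<in> carrier_mat p p" using Q by auto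
  have left: "transpose_mat T * four_block_mat (b \<cdot>\<^sub>m Q) (transpose_mat (F * C)) (F * C)
        (C + transpose_mat C - Q) =
     four_block_mat (?G * (b \<cdot>\<^sub>m Q)) (?G * transpose_mat (F * C)) (?G * (F * C))
       (?G * (C + transpose_mat C - Q))"
    unfolding Tt mult_four_block_mat[OF Gt Z Z Gt Qb FC(2,1) D]
      left_mult_zero_mat[OF FC(1)] left_mult_zero_mat[OF FC(2)]
    using Gt Q FC D by (simp del: assoc_mult_mat)
  note blocks = mult_carrier_mat[OF Gt Qb] mult_carrier_mat[OF Gt FC(2)]
    mult_carrier_mat[OF Gt FC(1)] mult_carrier_mat[OF Gt D]
  have right: "four_block_mat (?G * (b \<cdot>\<^sub>m Q)) (?G * transpose_mat (F * C)) (?G * (F * C))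
       (?G * (C + transpose_mat C - Q)) * T =
     four_block_mat (?G * (b \<cdot>\<^sub>m Q) * G) (?G * transpose_mat (F * C) * G) (?G * (F * C) * G)
       (?G * (C + transpose_mat C - Q) * G)"
    unfolding T_def mult_four_block_mat[OF blocks G Z Z G]
    using blocks[THEN right_mult_zero_mat] blocks[THEN mult_carrier_mat, OF G]
    by (simp del: assoc_mult_mat)
  have upper_left: "?G * (b \<cdot>\<^sub>m Q) * G = b \<cdot>\<^sub>m (?G * Q * G)"
    unfolding mult_smult_distrib[OF Gt Q] mult_smult_assoc_mat[OF mult_carrier_mat[OF Gt Q] G] ..
  have upper_right: "?G * transpose_mat (F * C) * G = transpose_mat F * G"
    unfolding transpose_mult[OF F C] assoc_mult_mat[OF Gt Ct Ft, symmetric] GC left_mult_one_mat[OF Ft] ..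
  have lower_left: "?G * (F * C) * G = ?G * F"
    unfolding assoc_mult_mat[OF Gt FC(1) G] assoc_mult_mat[OF F C G] CG right_mult_one_mat[OF F] ..
  have CCt: "C + transpose_mat C \<in> carrier_mat p p" using C by simp
  \<comment> \<open>After expansion, the term from \<open>C\<close> leaves the transpose of
    \<open>G\<close>, the term from its transpose leaves \<open>G\<close>, and the term from
    \<open>Q\<close> becomes the congruence of \<open>Q\<close>.\<close>
  have lower_right: "?G * (C + transpose_mat C - Q) * G = ?G + G - ?G * Q * G"
    unfolding mult_minus_distrib_mat[OF Gt CCt Q] mult_add_distrib_mat[OF Gt C Ct] GC
      minus_mult_distrib_mat[OF add_carrier_mat[OF one_carrier_mat] mult_carrier_mat[OF Gt Q] G]
      add_mult_distrib_mat[OF mult_carrier_mat[OF Gt C] one_carrier_mat G]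
      assoc_mult_mat[OF Gt C G] CG right_mult_one_mat[OF Gt] left_mult_one_mat[OF G] ..
  show ?thesis unfolding left right upper_left upper_right lower_left lower_right ..
qed

lemma S1_eq_congruence:
  assumes Q: "Q \<in> carrier_mat (ntil n) (ntil n)"
    and H: "H \<in> carrier_mat n n" and L: "L \<in> carrier_mat m n"
    and Hi: "Hi \<in> carrier_mat n n" "Hi * H = 1\<^sub>m n"
    and G: "G \<in> carrier_mat (ntil n) (ntil n)" "Cop n (H \<otimes>\<^sub>k H) * G = 1\<^sub>m (ntil n)"
  defines "T \<equiv> four_block_mat G (0\<^sub>m (ntil n) (ntil n)) (0\<^sub>m (ntil n) (ntil n)) G"
  shows "S1 n m M (transpose_mat G * Q * G) G (L * Hi) b = transpose_mat T * Sqmi n m M Q H L b * T"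
proof -
  have F: "Cop n (FK n m M (L * Hi)) \<in> carrier_mat (ntil n) (ntil n)"
    using mult_carrier_mat[OF L Hi(1)] by simp
  have C: "Cop n (H \<otimes>\<^sub>k H) \<in> carrier_mat (ntil n) (ntil n)" using kron_carrier[OF H H] by simp
  show ?thesis
    unfolding S1_def Sqmi_def Fqmi_eq_Cop_FK_mult[OF H L Hi] T_def
    by (rule block_congruence[OF Q F C G])
qed

section \<open>Existence of the inverses and transfer of definiteness\<close>

lemma Fqmi_carrier [simp]:
  assumes "H \<in> carrier_mat n n" "L \<in> carrier_mat m n"
  shows "Fqmi n m M L H \<in> carrier_mat (ntil n) (ntil n)"
  unfolding Fqmi_def using assms
  by (intro Cop_carrier) (auto simp: Faa_def Fab_def Fba_def Fbb_def kron_def)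

lemma Sqmi_carrier [simp]:
  assumes "Q \<in> carrier_mat (ntil n) (ntil n)" "H \<in> carrier_mat n n" "L \<in> carrier_mat m n"
  shows "Sqmi n m M Q H L b \<in> carrier_mat (ntil n + ntil n) (ntil n + ntil n)"
  unfolding Sqmi_def using assms by (intro four_block_carrier_mat) auto

text \<open>The lower right block of a semidefinite matrix is nonnegative, so the symmetric part of
  the compressed Kronecker square dominates \<open>Q\<close>; invertibility of \<open>H\<close> then
  follows from that of the compression.\<close>

lemma invertible_if_psd_Sqmi:
  assumes Q: "Q \<in> carrier_mat (ntil n) (ntil n)" "pd_mat Q"
    and H: "H \<in> carrier_mat n n" and L: "L \<in> carrier_mat m n"
    and psd: "psd_mat (Sqmi n m M Q H L b)"
  shows "invertible_mat H" and "invertible_mat (Cop n (H \<otimes>\<^sub>k H))"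
proof -
  let ?C = "Cop n (H \<otimes>\<^sub>k H)" and ?F = "Fqmi n m M L H"
  have C: "?C \<in> carrier_mat (ntil n) (ntil n)" using kron_carrier[OF H H] by simp
  have F: "?F \<in> carrier_mat (ntil n) (ntil n)" using H L by simp
  show inv: "invertible_mat ?C"
  proof (rule invertible_mat_if_symmetric_part_dominates[OF C Q])
    fix x :: "real vec" assume "x \<in> carrier_vec (ntil n)"
    then show "0 \<le> x \<bullet> ((?C + transpose_mat ?C - Q) *\<^sub>v x)"
      using psd Q C F unfolding Sqmi_def
      by (intro psd_mat_lower_right_block[of "b\<^sup>2 \<cdot>\<^sub>m Q" "ntil n" "transpose_mat ?F" "ntil n" ?F]) auto
  qed
  show "invertible_mat H" by (rule invertible_mat_if_Cop_kron_invertible[OF H inv])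
qed

lemma S1_definite_if_Sqmi_definite:
  assumes Q: "Q \<in> carrier_mat (ntil n) (ntil n)" "pd_mat Q"
    and H: "H \<in> carrier_mat n n" and L: "L \<in> carrier_mat m n"
    and Hi: "Hi \<in> carrier_mat n n" "Hi * H = 1\<^sub>m n"
    and G: "G \<in> carrier_mat (ntil n) (ntil n)" "Cop n (H \<otimes>\<^sub>k H) * G = 1\<^sub>m (ntil n)"
      "G * Cop n (H \<otimes>\<^sub>k H) = 1\<^sub>m (ntil n)"
  shows "pd_mat (transpose_mat G * Q * G)"
    and "psd_mat (Sqmi n m M Q H L b) \<Longrightarrow> psd_mat (S1 n m M (transpose_mat G * Q * G) G (L * Hi) b)"
    and "pd_mat (Sqmi n m M Q H L b) \<Longrightarrow> pd_mat (S1 n m M (transpose_mat G * Q * G) G (L * Hi) b)"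
proof -
  let ?p = "ntil n"
  let ?C = "Cop n (H \<otimes>\<^sub>k H)"
  let ?T = "four_block_mat G (0\<^sub>m ?p ?p) (0\<^sub>m ?p ?p) G"
  \<comment> \<open>This left inverse of \<open>?T\<close> is what carries strict definiteness
    through the congruence.\<close>
  let ?U = "four_block_mat ?C (0\<^sub>m ?p ?p) (0\<^sub>m ?p ?p) ?C"
  have C: "?C \<in> carrier_mat ?p ?p" using kron_carrier[OF H H] by simp
  have T: "?T \<in> carrier_mat (?p + ?p) (?p + ?p)" and U: "?U \<in> carrier_mat (?p + ?p) (?p + ?p)"
    using G(1) C by auto
  have UT: "?U * ?T = 1\<^sub>m (?p + ?p)"
    unfolding mult_four_block_mat[OF C zero_carrier_mat zero_carrier_mat C G(1) zero_carrier_mat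
        zero_carrier_mat G(1)]
    using C G by (simp add: four_block_one_mat)
  note S = Sqmi_carrier[OF Q(1) H L]
  note eq = S1_eq_congruence[OF Q(1) H L Hi G(1,2)]
  \<comment> \<open>Here \<open>?C\<close> serves as the left inverse of \<open>G\<close>.\<close>
  show "pd_mat (transpose_mat G * Q * G)" by (rule pd_mat_congruence[OF Q(1) G(1) Q(2) C G(2)])
  show "psd_mat (Sqmi n m M Q H L b) \<Longrightarrow> psd_mat (S1 n m M (transpose_mat G * Q * G) G (L * Hi) b)"
    unfolding eq by (rule psd_mat_congruence[OF S T])
  show "pd_mat (Sqmi n m M Q H L b) \<Longrightarrow> pd_mat (S1 n m M (transpose_mat G * Q * G) G (L * Hi) b)"
    unfolding eq by (rule pd_mat_congruence[OF S T _ U UT])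
qed

theorem theorem7:
  fixes n m N :: nat and \<beta> :: real and M :: "nat \<Rightarrow> real mat"
  assumes "0 < n" and "0 < m" and "0 < N"
    and "0 < \<beta>" and "\<beta> < 1"
    and M: "\<forall>k\<in>{1..N}. M k \<in> carrier_mat (n * (n + m)) (n * (n + m)) \<and> transpose_mat (M k) = M k"
  shows
   "(\<forall>(Q :: nat \<Rightarrow> real mat) H L.
      (\<forall>k\<in>{1..N}. Q k \<in> carrier_mat (ntil n) (ntil n) \<and> pd_mat (Q k)) \<and>
      H \<in> carrier_mat n n \<and> L \<in> carrier_mat m n \<and>
      (\<forall>k\<in>{1..N}. psd_mat (Sqmi n m (M k) (Q k) H L \<beta>)) \<longrightarrow>
      invertible_mat H \<and> invertible_mat (Cop n (H \<otimes>\<^sub>k H)) \<and>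
      (\<forall>Hi G. Hi \<in> carrier_mat n n \<and> inverts_mat H Hi \<and> inverts_mat Hi H \<and>
              G \<in> carrier_mat (ntil n) (ntil n) \<and>
              inverts_mat (Cop n (H \<otimes>\<^sub>k H)) G \<and> inverts_mat G (Cop n (H \<otimes>\<^sub>k H)) \<longrightarrow>
         (\<forall>k\<in>{1..N}. pd_mat (transpose_mat G * Q k * G) \<and>
            psd_mat (S1 n m (M k) (transpose_mat G * Q k * G) G (L * Hi) \<beta>)) \<and>
         ((\<forall>k\<in>{1..N}. \<forall>j\<in>{1..N}. Q k = Q j) \<longrightarrow>
            (\<forall>k\<in>{1..N}. \<forall>j\<in>{1..N}. transpose_mat G * Q k * G = transpose_mat G * Q j * G))))
   \<and>
   (\<forall>(Q :: nat \<Rightarrow> real mat) H L.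
      (\<forall>k\<in>{1..N}. Q k \<in> carrier_mat (ntil n) (ntil n) \<and> pd_mat (Q k)) \<and>
      H \<in> carrier_mat n n \<and> L \<in> carrier_mat m n \<and>
      (\<forall>k\<in>{1..N}. pd_mat (Sqmi n m (M k) (Q k) H L 1)) \<longrightarrow>
      invertible_mat H \<and> invertible_mat (Cop n (H \<otimes>\<^sub>k H)) \<and>
      (\<forall>Hi G. Hi \<in> carrier_mat n n \<and> inverts_mat H Hi \<and> inverts_mat Hi H \<and>
              G \<in> carrier_mat (ntil n) (ntil n) \<and>
              inverts_mat (Cop n (H \<otimes>\<^sub>k H)) G \<and> inverts_mat G (Cop n (H \<otimes>\<^sub>k H)) \<longrightarrow>
         (\<forall>k\<in>{1..N}. pd_mat (transpose_mat G * Q k * G) \<and>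
            pd_mat (S1 n m (M k) (transpose_mat G * Q k * G) G (L * Hi) 1)) \<and>
         ((\<forall>k\<in>{1..N}. \<forall>j\<in>{1..N}. Q k = Q j) \<longrightarrow>
            (\<forall>k\<in>{1..N}. \<forall>j\<in>{1..N}. transpose_mat G * Q k * G = transpose_mat G * Q j * G))))"
proof -
  have one: "1 \<in> {1..N}" using \<open>0 < N\<close> by simp
  \<comment> \<open>As \<open>H\<close> and \<open>L\<close> are shared by all vertices, one vertex
    suffices; the first exists because \<open>N\<close> is positive. Stating this for arbitrary
    \<open>b\<close> covers both conditions.\<close>
  have invertible: "invertible_mat H" "invertible_mat (Cop n (H \<otimes>\<^sub>k H))"
    if "\<forall>k\<in>{1..N}. Q k \<in> carrier_mat (ntil n) (ntil n) \<and> pd_mat (Q k)"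
      "H \<in> carrier_mat n n" "L \<in> carrier_mat m n"
      "\<forall>k\<in>{1..N}. psd_mat (Sqmi n m (M k) (Q k) H L b)" for Q H L b
    using invertible_if_psd_Sqmi[of "Q 1" n H L m "M 1" b] that one by blast+
  have definite: "pd_mat (transpose_mat G * Q * G)"
      "psd_mat (Sqmi n m A Q H L b) \<Longrightarrow> psd_mat (S1 n m A (transpose_mat G * Q * G) G (L * Hi) b)"
      "pd_mat (Sqmi n m A Q H L b) \<Longrightarrow> pd_mat (S1 n m A (transpose_mat G * Q * G) G (L * Hi) b)"
    if Q: "Q \<in> carrier_mat (ntil n) (ntil n) \<and> pd_mat Q"
      and H: "H \<in> carrier_mat n n" and L: "L \<in> carrier_mat m n"
      and Hi: "Hi \<in> carrier_mat n n" "inverts_mat Hi H"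
      and G: "G \<in> carrier_mat (ntil n) (ntil n)"
        "inverts_mat (Cop n (H \<otimes>\<^sub>k H)) G" "inverts_mat G (Cop n (H \<otimes>\<^sub>k H))"
    for Q H L Hi G A b
  proof -
    have "Hi * H = 1\<^sub>m n" "Cop n (H \<otimes>\<^sub>k H) * G = 1\<^sub>m (ntil n)" "G * Cop n (H \<otimes>\<^sub>k H) = 1\<^sub>m (ntil n)"
      using Hi G Cop_carrier[OF kron_carrier[OF H H]] unfolding inverts_mat_def by auto
    note S1_definite_if_Sqmi_definite[OF conjunct1[OF Q] conjunct2[OF Q] H L Hi(1) this(1) G(1) this(2,3)]
    then show "pd_mat (transpose_mat G * Q * G)"
      "psd_mat (Sqmi n m A Q H L b) \<Longrightarrow> psd_mat (S1 n m A (transpose_mat G * Q * G) G (L * Hi) b)"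
      "pd_mat (Sqmi n m A Q H L b) \<Longrightarrow> pd_mat (S1 n m A (transpose_mat G * Q * G) G (L * Hi) b)"
      by blast+
  qed
  show ?thesis
    apply (intro conjI allI impI ballI; elim conjE)
    subgoal by (rule invertible(1))
    subgoal by (rule invertible(2))
    subgoal by (rule definite(1)) (assumption | erule (1) bspec)+
    subgoal by (rule definite(2)) (assumption | erule (1) bspec)+
    subgoal by metis
    \<comment> \<open>In the strict case invertibility is obtained by weakening to
      semidefiniteness.\<close>
    subgoal by (rule invertible(1)) (auto intro: pd_mat_imp_psd_mat)
    subgoal by (rule invertible(2)) (auto intro: pd_mat_imp_psd_mat)
    subgoal by (rule definite(1)) (assumption | erule (1) bspec)+
    subgoal by (rule definite(3)) (assumption | erule (1) bspec)+
    subgoal by metis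
    done
qed

end
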